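(* Let $a_n$ be the number of lattice paths from $(0,0)$ to $(n,n)$ using steps $(0,1)$ and $(1,0)$, and also the step $(1,1)$ but only from a point on the diagonal $\{(i,i)\}$; let $a_{n,k}$ be the number of such paths using exactly $k$ steps $(1,1)$. Then for all $n\ge k\ge0$, $$\mathrm{Der}^2(\mathrm{Cat})_{n,k}=a_{n,k}=4^{n-k}\binom{n-\frac{k+1}{2}}{n-k},$$ and $$a_n=\sum_{k=0}^n4^{n-k}\binom{n-\frac{k+1}{2}}{n-k}.$$
   Context: $C(t)=\frac{1-\sqrt{1-4t}}{2t}$ is the Catalan generating function and $\mathrm{Cat}=\mathcal{R}(C(t),tC(t))$, where for formal power series $d(t),h(t)$ with $d(0)\neq0$, $h(0)=0$, $h'(0)\neq0$, $\mathcal{R}(d(t),h(t))$ is the infinite lower triangular matrix with $(n,k)$-entry $[t^n]\,d(t)h(t)^k$. $\mathrm{Der}(\mathcal{R}(d(t),h(t)))=\mathcal{R}(h'(t),t\,d(t))$ and $\mathrm{Der}^2=\mathrm{Der}\circ\mathrm{Der}$ (one has $\mathrm{Der}^2(\mathrm{Cat})=\mathcal{R}(1/\sqrt{1-4t},t/\sqrt{1-4t})$). For real $x$ and integer $m\ge0$, $\binom{x}{m}=x(x-1)\cdots(x-m+1)/m!$. *)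

theory Defs
  imports "HOL-Computational_Algebra.Formal_Power_Series" "HOL-Library.Product_Plus"
begin

definition riordan_pair :: "real fps \<Rightarrow> real fps \<Rightarrow> bool" where
  "riordan_pair d h \<longleftrightarrow> fps_nth d 0 \<noteq> 0 \<and> fps_nth h 0 = 0 \<and> fps_nth h 1 \<noteq> 0"

definition riordan :: "real fps \<Rightarrow> real fps \<Rightarrow> nat \<Rightarrow> nat \<Rightarrow> real" where
  "riordan d h = (\<lambda>n k. fps_nth (d * h ^ k) n)"

text \<open>\<open>Der\<close> acts on matrices; it is meaningful only on Riordan arrays, where the pair
  \<open>(d, h)\<close> is determined by the matrix.\<close>

definition Der :: "(nat \<Rightarrow> nat \<Rightarrow> real) \<Rightarrow> nat \<Rightarrow> nat \<Rightarrow> real" where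
  "Der A = (THE B. \<exists>d h. riordan_pair d h \<and> A = riordan d h \<and>
                         B = riordan (fps_deriv h) (fps_X * d))"

lemma riordan_inject:
  assumes "riordan_pair d h" "riordan d h = riordan d' h'"
  shows "d' = d \<and> h' = h"
proof -
  have col: "d * h ^ k = d' * h' ^ k" for k
    using assms(2) by (auto simp: riordan_def fun_eq_iff fps_eq_iff)
  have "d \<noteq> 0" using assms(1) by (auto simp: riordan_pair_def)
  with col[of 0] col[of 1] show ?thesis by simp
qed

lemma Der_riordan:
  assumes "riordan_pair d h"
  shows "Der (riordan d h) = riordan (fps_deriv h) (fps_X * d)"
  unfolding Der_def
  by (rule the_equality) (use assms riordan_inject[OF assms] in blast)+

lemma riordan_pair_Der:
  "riordan_pair d h \<Longrightarrow> riordan_pair (fps_deriv h) (fps_X * d)"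
  by (simp add: riordan_pair_def)

text \<open>The quotient is the exact one in the ring of formal power series: the numerator
  is divisible by \<open>fps_X\<close>, since \<open>fps_radical root 2\<close> yields the square root with constant
  term \<open>1\<close>.\<close>

definition Catalan_gf :: "real fps" where
  "Catalan_gf = (1 - fps_radical root 2 (1 - 4 * fps_X)) / (2 * fps_X)"

definition Cat :: "nat \<Rightarrow> nat \<Rightarrow> real" where
  "Cat = riordan Catalan_gf (fps_X * Catalan_gf)"

text \<open>A path starting at the origin is encoded by its list of steps, so
  \<open>sum_list (take i p)\<close> is the point reached after \<open>i\<close> steps.\<close>

definition lattice_paths :: "nat \<Rightarrow> (nat \<times> nat) list set" where
  "lattice_paths n = {p. set p \<subseteq> {(0, 1), (1, 0), (1, 1)} \<and> sum_list p = (n, n) \<and>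
     (\<forall>i < length p. p ! i = (1, 1) \<longrightarrow> sum_list (take i p) \<in> {(j, j) | j. True})}"

definition num_paths :: "nat \<Rightarrow> nat" where
  "num_paths n = card (lattice_paths n)"

definition num_paths_diag :: "nat \<Rightarrow> nat \<Rightarrow> nat" where
  "num_paths_diag n k = card {p \<in> lattice_paths n. count_list p (1, 1) = k}"

end

theory Submission imports Defs begin

text \<open>Let \<open>F = (1 - 4t)^(-1/2)\<close>. Since \<open>t C(t) = (1 - sqrt (1 - 4t)) / 2\<close> has derivative \<open>F\<close>,
  applying \<open>Der\<close> twice to \<open>Cat\<close> gives the Riordan array of \<open>(F, t F)\<close>. On the other hand,
  \<open>F\<close> counts the paths from the diagonal to itself without diagonal steps (central binomial
  coefficients), and cutting a path at its first diagonal step shows that the paths with \<open>k\<close>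
  diagonal steps have generating function \<open>F (t F)\<^sup>k = t\<^sup>k (1 - 4t)^(-(k+1)/2)\<close>. The
  binomial series then yields the closed form.\<close>

section \<open>The generating function\<close>

text \<open>The series \<open>(1 - 4t)^c\<close> for real \<open>c\<close>, so that square roots,
  inverses and powers all become arithmetic on exponents.\<close>

abbreviation binomial_gf :: "real \<Rightarrow> real fps" where
  "binomial_gf c \<equiv> fps_binomial c oo (fps_const (- 4) * fps_X)"

lemma binomial_gf_mult: "binomial_gf c * binomial_gf d = binomial_gf (c + d)"
  by (simp add: fps_binomial_add_mult fps_compose_mult_distrib)

lemma binomial_gf_power: "binomial_gf c ^ n = binomial_gf (of_nat n * c)"
  by (simp add: fps_compose_power fps_binomial_power)

lemma binomial_gf_1: "binomial_gf 1 = 1 - 4 * fps_X"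
  by (simp add: fps_binomial_1 fps_compose_add_distrib numeral_fps_const flip: fps_const_neg)

lemma sqrt_gf: "fps_radical root 2 (1 - 4 * fps_X) = binomial_gf (1 / 2)"
proof -
  \<comment> \<open>\<open>Suc 1\<close> instead of \<open>2\<close> matches the index in
    \<open>radical_unique\<close>. The root is singled out by its square and its constant term
    \<open>1\<close>.\<close>
  have "binomial_gf (1 / 2) ^ Suc 1 = 1 - 4 * fps_X"
    by (subst binomial_gf_power) (simp add: binomial_gf_1)
  then have "binomial_gf (1 / 2) = fps_radical root (Suc 1) (1 - 4 * fps_X)"
    by (subst (asm) radical_unique[where r = root]) auto
  then show ?thesis
    by (simp only: Suc_1)
qed

lemma X_times_Catalan_gf: "2 * (fps_X * Catalan_gf) = 1 - binomial_gf (1 / 2)"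
proof -
  let ?N = "1 - binomial_gf (1 / 2)"
  \<comment> \<open>The constant term of \<open>?N\<close> is zero, so \<open>?N\<close> is
    divisible by \<open>fps_X\<close>; as \<open>2\<close> is a unit, also by
    \<open>2 * fps_X\<close>. Hence the quotient in \<open>Catalan_gf\<close> is exact.\<close>
  have "fps_nth ?N n = fps_nth (fps_X * fps_shift 1 ?N) n" for n
    by (cases n) (simp_all add: fps_X_mult_nth)
  then have "?N = fps_X * fps_shift 1 ?N"
    by (rule fps_ext)
  also have "\<dots> = (2 * fps_const (1 / 2)) * (fps_X * fps_shift 1 ?N)"
    by (simp add: numeral_fps_const)
  also have "\<dots> = (2 * fps_X) * (fps_const (1 / 2) * fps_shift 1 ?N)"
    by (simp only: mult_ac)
  finally have "2 * fps_X dvd ?N"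
    by (rule dvdI)
  then show ?thesis
    by (simp add: Catalan_gf_def sqrt_gf dvd_mult_div_cancel mult.assoc[symmetric])
qed

text \<open>With \<open>S = binomial_gf (1 / 2)\<close>, differentiating
  \<open>S * S = 1 - 4t\<close> gives \<open>2 * S * S' = -4\<close>. As
  \<open>2 * (t C)' = -S'\<close>, the derivative of \<open>t C\<close> is the inverse of
  \<open>S\<close>.\<close>

lemma deriv_X_times_Catalan_gf: "fps_deriv (fps_X * Catalan_gf) = binomial_gf (- (1 / 2))"
proof -
  let ?S = "binomial_gf (1 / 2)"
  have "?S * fps_deriv (2 * (fps_X * Catalan_gf)) * 2 = ?S * (- fps_deriv ?S) * 2"
    unfolding X_times_Catalan_gf by simp
  also have "\<dots> = - fps_deriv (?S * ?S)"
    by (simp only: fps_deriv_mult) (simp add: algebra_simps)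
  also have "\<dots> = 4"
    by (simp add: binomial_gf_mult binomial_gf_1)
  also have "fps_deriv (2 * (fps_X * Catalan_gf)) = 2 * fps_deriv (fps_X * Catalan_gf)"
    by (subst fps_deriv_mult) simp
  finally have "4 * (?S * fps_deriv (fps_X * Catalan_gf)) = 4 * 1"
    by (simp only: mult_ac) simp
  then have "?S * fps_deriv (fps_X * Catalan_gf) = 1"
    by (simp only: mult_cancel_left) simp
  moreover have "?S * binomial_gf (- (1 / 2)) = 1"
    by (simp add: binomial_gf_mult)
  ultimately have "?S * fps_deriv (fps_X * Catalan_gf) = ?S * binomial_gf (- (1 / 2))"
    by (simp only:)
  moreover have "?S \<noteq> 0"
    using \<open>?S * binomial_gf (- (1 / 2)) = 1\<close> by fastforce
  ultimately show ?thesis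
    by (simp only: mult_cancel_left) simp
qed

lemma Der2_Cat:
  "(Der ^^ 2) Cat = riordan (binomial_gf (- (1 / 2))) (fps_X * binomial_gf (- (1 / 2)))"
proof -
  let ?h = "fps_X * Catalan_gf"
  have "fps_nth Catalan_gf 0 = fps_nth (fps_deriv ?h) 0"
    by simp
  also have "\<dots> = 1"
    unfolding deriv_X_times_Catalan_gf by simp
  finally have pair: "riordan_pair Catalan_gf ?h"
    by (simp add: riordan_pair_def)
  \<comment> \<open>For \<open>Cat\<close>, \<open>fps_X * d\<close> is \<open>?h\<close> itself, so
    the first \<open>Der\<close> changes only the first component.\<close>
  have "(Der ^^ 2) Cat = Der (riordan (fps_deriv ?h) ?h)"
    using Der_riordan[OF pair] by (simp only: Cat_def numeral_2_eq_2 funpow.simps comp_def id_def)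
  also have "\<dots> = riordan (fps_deriv ?h) (fps_X * fps_deriv ?h)"
    by (rule Der_riordan[OF riordan_pair_Der[OF pair]])
  finally show ?thesis
    by (simp only: deriv_X_times_Catalan_gf)
qed

text \<open>Negating the upper index of the binomial coefficient produces the sign
  \<open>(-1)^n\<close>, which cancels the sign of \<open>(-4)^n\<close>.\<close>

lemma binomial_gf_nth: "fps_nth (binomial_gf (- c)) n = 4 ^ n * ((c + real n - 1) gchoose n)"
  by (simp add: gbinomial_minus flip: power_mult_distrib mult.assoc)

text \<open>The rising factorial \<open>(1/2)(3/2)...(n - 1/2)\<close> equals
  \<open>(2n)! / (4^n n!)\<close>.\<close>

lemma central_gf_nth: "fps_nth (binomial_gf (- (1 / 2))) n = real ((2 * n) choose n)"
  by (simp add: gbinomial_pochhammer binomial_fact fact_double power_mult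
      flip: power_mult_distrib mult.assoc)

section \<open>Counting lattice paths\<close>

definition grid_paths :: "nat \<Rightarrow> nat \<Rightarrow> (nat \<times> nat) list set" where
  "grid_paths m n = {p. set p \<subseteq> {(0, 1), (1, 0)} \<and> sum_list p = (m, n)}"

text \<open>Every step raises the coordinate sum by at least one. This bounds the length of a path
  with given endpoint, hence makes such paths finite in number.\<close>

lemma length_le_sum_list:
  "set p \<subseteq> {(0, 1), (1, 0), (1, 1)} \<Longrightarrow> length p \<le> fst (sum_list p) + snd (sum_list p)"
  for p :: "(nat \<times> nat) list"
  by (induction p) auto

lemma finite_step_lists:
  "finite {p. set p \<subseteq> {(0, 1), (1, 0), (1, 1)} \<and> sum_list p = (m, n)}" for m n :: nat
proof (rule finite_subset)
  show "{p. set p \<subseteq> {(0, 1), (1, 0), (1, 1)} \<and> sum_list p = (m, n)}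
      \<subseteq> {p. set p \<subseteq> {(0, 1), (1, 0), (1, 1)} \<and> length p \<le> m + n}"
    using length_le_sum_list by fastforce
qed (rule finite_lists_length_le, simp)

lemma finite_grid_paths: "finite (grid_paths m n)"
  by (rule finite_subset[OF _ finite_step_lists[of m n]]) (auto simp: grid_paths_def)

lemma finite_lattice_paths: "finite (lattice_paths n)"
  by (rule finite_subset[OF _ finite_step_lists[of n n]]) (auto simp: lattice_paths_def)

lemma Cons_mem_grid_paths:
  "x # p \<in> grid_paths m n \<longleftrightarrow>
    x = (1, 0) \<and> m \<noteq> 0 \<and> p \<in> grid_paths (m - 1) n \<or>
    x = (0, 1) \<and> n \<noteq> 0 \<and> p \<in> grid_paths m (n - 1)"
  by (cases "sum_list p") (auto simp: grid_paths_def)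

lemma card_grid_paths: "card (grid_paths m n) = (m + n) choose m"
proof (induction "m + n" arbitrary: m n)
  case 0
  have "grid_paths 0 0 = {[]}"
  proof (intro set_eqI)
    show "p \<in> grid_paths 0 0 \<longleftrightarrow> p \<in> {[]}" for p
      by (cases p) (auto simp: Cons_mem_grid_paths, auto simp: grid_paths_def zero_prod_def)
  qed
  with 0 show ?case by simp
next
  case (Suc l)
  \<comment> \<open>Splitting by the first step leads to Pascal's rule. The guards exclude steps
    that would leave the quadrant, where truncated subtraction would give wrong paths.\<close>
  let ?A = "if m = 0 then {} else Cons (1, 0) ` grid_paths (m - 1) n"
  let ?B = "if n = 0 then {} else Cons (0, 1) ` grid_paths m (n - 1)"
  have "grid_paths m n = ?A \<union> ?B"
  proof (intro set_eqI)
    show "p \<in> grid_paths m n \<longleftrightarrow> p \<in> ?A \<union> ?B" for p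
      using Suc(2)
      by (cases p) (auto simp: Cons_mem_grid_paths, auto simp: grid_paths_def zero_prod_def)
  qed
  then have "card (grid_paths m n) = card ?A + card ?B"
    by (simp only:, intro card_Un_disjoint) (auto simp: finite_grid_paths)
  also have "\<dots> = (if m = 0 then 0 else l choose (m - 1)) + (if n = 0 then 0 else l choose m)"
  proof -
    have "card (grid_paths (m - 1) n) = l choose (m - 1)" if "m \<noteq> 0"
      using Suc(1)[of "m - 1" n] Suc(2) that by (cases m) auto
    moreover have "card (grid_paths m (n - 1)) = l choose m" if "n \<noteq> 0"
      using Suc(1)[of m "n - 1"] Suc(2) that by (cases n) auto
    ultimately show ?thesis by (auto simp: card_image)
  qed
  also have "\<dots> = (m + n) choose m"
    using Suc(2) by (cases m; cases n) (auto simp: binomial_eq_0)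
  finally show ?case .
qed

text \<open>The diagonal condition of \<open>lattice_paths\<close> without the endpoint, so that it
  applies to the pieces of a path.\<close>

definition diagonal_ok :: "(nat \<times> nat) list \<Rightarrow> bool" where
  "diagonal_ok p \<longleftrightarrow>
    (\<forall>i < length p. p ! i = (1, 1) \<longrightarrow> sum_list (take i p) \<in> {(j, j) | j. True})"

text \<open>Translation by \<open>(i, i)\<close> maps the diagonal to itself, so \<open>r\<close>
  may be judged as if it started at the origin.\<close>

lemma diagonal_ok_append:
  assumes "sum_list q = (i, i)"
  shows "diagonal_ok (q @ r) \<longleftrightarrow> diagonal_ok q \<and> diagonal_ok r"
proof
  assume ok: "diagonal_ok (q @ r)"
  have "diagonal_ok q"
    unfolding diagonal_ok_def
  proof (intro allI impI)
    fix j assume "j < length q" "q ! j = (1, 1)"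
    with ok show "sum_list (take j q) \<in> {(j, j) |j. True}"
      unfolding diagonal_ok_def by (auto simp: nth_append dest!: spec[of _ j])
  qed
  moreover have "diagonal_ok r"
    unfolding diagonal_ok_def
  proof (intro allI impI)
    fix j assume "j < length r" "r ! j = (1, 1)"
    with ok obtain l where "(i, i) + sum_list (take j r) = (l, l)"
      unfolding diagonal_ok_def using assms
      by (auto simp: nth_append dest!: spec[of _ "length q + j"])
    then show "sum_list (take j r) \<in> {(j, j) |j. True}"
      by (cases "sum_list (take j r)") auto
  qed
  ultimately show "diagonal_ok q \<and> diagonal_ok r" ..
next
  assume ok: "diagonal_ok q \<and> diagonal_ok r"
  show "diagonal_ok (q @ r)"
    unfolding diagonal_ok_def
  proof (intro allI impI)
    fix j assume j: "j < length (q @ r)" "(q @ r) ! j = (1, 1)"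
    show "sum_list (take j (q @ r)) \<in> {(j, j) |j. True}"
    proof (cases "j < length q")
      case True
      with j ok show ?thesis by (auto simp: diagonal_ok_def nth_append)
    next
      case False
      with j ok have "sum_list (take (j - length q) r) \<in> {(j, j) |j. True}"
        by (auto simp: diagonal_ok_def nth_append)
      with False assms show ?thesis by auto
    qed
  qed
qed

lemma diagonal_ok_no_diagonal: "(1, 1) \<notin> set p \<Longrightarrow> diagonal_ok p"
  by (auto simp: diagonal_ok_def in_set_conv_nth)

lemma diagonal_ok_singleton: "diagonal_ok [x]"
  by (auto simp: diagonal_ok_def zero_prod_def)

lemma diagonal_ok_split: "diagonal_ok (q @ (1, 1) # r) \<Longrightarrow> \<exists>i. sum_list q = (i, i)"
  by (auto simp: diagonal_ok_def dest!: spec[of _ "length q"])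

definition diag_paths :: "nat \<Rightarrow> nat \<Rightarrow> (nat \<times> nat) list set" where
  "diag_paths n k = {p \<in> lattice_paths n. count_list p (1, 1) = k}"

lemma mem_diag_paths:
  "p \<in> diag_paths n k \<longleftrightarrow> set p \<subseteq> {(0, 1), (1, 0), (1, 1)} \<and> sum_list p = (n, n) \<and>
     diagonal_ok p \<and> count_list p (1, 1) = k"
  by (auto simp: diag_paths_def lattice_paths_def diagonal_ok_def)

lemma finite_diag_paths: "finite (diag_paths n k)"
  by (simp add: diag_paths_def finite_lattice_paths)

lemma diag_paths_0: "diag_paths n 0 = grid_paths n n"
proof -
  have "(1, 1) \<notin> {(0, 1), (1 :: nat, 0 :: nat)}"
    by simp
  then have "set p \<subseteq> {(0, 1), (1, 0), (1, 1)} \<and> (1, 1) \<notin> set p \<longleftrightarrow> set p \<subseteq> {(0, 1), (1, 0)}"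
    for p :: "(nat \<times> nat) list"
    by blast
  then show ?thesis
    unfolding set_eq_iff mem_diag_paths grid_paths_def count_list_0_iff mem_Collect_eq
    using diagonal_ok_no_diagonal by metis
qed

lemma append_Cons_first_inject:
  "\<lbrakk>x \<notin> set q; x \<notin> set q'\<rbrakk> \<Longrightarrow> q @ x # r = q' @ x # r' \<longleftrightarrow> q = q' \<and> r = r'"
  by (auto simp: append_eq_append_conv2 append_eq_Cons_conv Cons_eq_append_conv)

text \<open>The first diagonal step starts at some \<open>(i, i)\<close> and uses one unit of each
  coordinate, which leaves \<open>n - 1 - i\<close> for the rest.\<close>

lemma card_diag_paths_Suc:
  "card (diag_paths n (Suc k)) =
    (\<Sum>i<n. card (diag_paths i 0) * card (diag_paths (n - 1 - i) k))"
proof -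
  let ?S = "SIGMA i:{..<n}. diag_paths i 0 \<times> diag_paths (n - 1 - i) k"
  have "bij_betw (\<lambda>(i, q, r). q @ (1, 1) # r) ?S (diag_paths n (Suc k))"
    unfolding bij_betw_def
  proof
    show "inj_on (\<lambda>(i, q, r). q @ (1, 1) # r) ?S"
      by (auto simp: inj_on_def mem_diag_paths count_list_0_iff append_Cons_first_inject)
  next
    show "(\<lambda>(i, q, r). q @ (1, 1) # r) ` ?S = diag_paths n (Suc k)"
    proof (intro equalityI subsetI)
      fix p assume "p \<in> (\<lambda>(i, q, r). q @ (1, 1) # r) ` ?S"
      then obtain i q r where p: "p = q @ [(1, 1)] @ r" and i: "i < n"
        and q: "q \<in> diag_paths i 0" and r: "r \<in> diag_paths (n - 1 - i) k"
        by auto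
      have "sum_list q = (i, i)"
        using q by (simp add: mem_diag_paths)
      then have "diagonal_ok p"
        using q r unfolding p mem_diag_paths
        by (simp add: diagonal_ok_append diagonal_ok_singleton del: append_Cons append.simps)
      with i q r show "p \<in> diag_paths n (Suc k)"
        by (simp add: mem_diag_paths p)
    next
      fix p assume p: "p \<in> diag_paths n (Suc k)"
      then have "(1, 1) \<in> set p"
        by (metis count_notin mem_diag_paths nat.distinct(1))
      then obtain q r where qr: "p = q @ (1, 1) # r" "(1, 1) \<notin> set q"
        by (meson split_list_first)
      with p obtain i where i: "sum_list q = (i, i)"
        using diagonal_ok_split unfolding mem_diag_paths by metis
      have "sum_list r = (n - 1 - i, n - 1 - i)" "i < n"
        using p i by (cases "sum_list r"; auto simp: mem_diag_paths qr(1))+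
      moreover have "diagonal_ok ([(1, 1)] @ r)"
        using p i by (auto simp: mem_diag_paths qr(1) diagonal_ok_append)
      \<comment> \<open>The single step \<open>(1, 1)\<close> is itself a path ending on the
        diagonal, so it can be stripped off.\<close>
      then have "diagonal_ok r"
        by (subst (asm) diagonal_ok_append[where i = 1]) auto
      ultimately have "(i, q, r) \<in> ?S"
        using p i qr by (auto simp: mem_diag_paths diagonal_ok_no_diagonal)
      with qr(1) show "p \<in> (\<lambda>(i, q, r). q @ (1, 1) # r) ` ?S"
        by force
    qed
  qed
  then have "card (diag_paths n (Suc k)) = card ?S"
    by (simp add: bij_betw_same_card)
  also have "\<dots> = (\<Sum>i<n. card (diag_paths i 0) * card (diag_paths (n - 1 - i) k))"
    by (simp add: card_SigmaI finite_diag_paths card_cartesian_product)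
  finally show ?thesis .
qed

lemma card_diag_paths_0_gf:
  "Abs_fps (\<lambda>n. real (card (diag_paths n 0))) = binomial_gf (- (1 / 2))"
  by (simp add: fps_eq_iff diag_paths_0 card_grid_paths central_gf_nth mult_2
      del: fps_nth_compose_linear)

lemma card_diag_paths_gf:
  "Abs_fps (\<lambda>n. real (card (diag_paths n k)))
    = binomial_gf (- (1 / 2)) * (fps_X * binomial_gf (- (1 / 2))) ^ k"
proof (induction k)
  case 0
  show ?case by (simp add: card_diag_paths_0_gf)
next
  case (Suc k)
  let ?A = "\<lambda>k. Abs_fps (\<lambda>n. real (card (diag_paths n k)))"
  \<comment> \<open>The recurrence is a Cauchy product; \<open>fps_X\<close> accounts for the cut
    step. At \<open>n = 0\<close> both sides vanish.\<close>
  have "?A (Suc k) = fps_X * (?A 0 * ?A k)"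
  proof (rule fps_ext)
    show "fps_nth (?A (Suc k)) n = fps_nth (fps_X * (?A 0 * ?A k)) n" for n
      by (cases n) (simp_all add: card_diag_paths_Suc lessThan_Suc_atMost fps_X_mult_nth
          del: sum.lessThan_Suc, simp add: fps_mult_nth atLeast0AtMost)
  qed
  then show ?case
    by (simp add: card_diag_paths_0_gf Suc.IH algebra_simps del: fps_nth_compose_linear)
qed

theorem theorem5p10:
  shows "(\<forall>n k. k \<le> n \<longrightarrow>
            (Der ^^ 2) Cat n k = real (num_paths_diag n k) \<and>
            real (num_paths_diag n k) =
              4 ^ (n - k) * ((real n - (real k + 1) / 2) gchoose (n - k))) \<and>
         (\<forall>n. real (num_paths n) =
            (\<Sum>k = 0..n. 4 ^ (n - k) * ((real n - (real k + 1) / 2) gchoose (n - k))))"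
proof -
  let ?F = "binomial_gf (- (1 / 2))"
  have num: "num_paths_diag n k = card (diag_paths n k)" for n k
    by (simp add: num_paths_diag_def diag_paths_def)
  have Der: "(Der ^^ 2) Cat n k = real (num_paths_diag n k)" for n k
    by (simp add: Der2_Cat riordan_def num flip: card_diag_paths_gf)
  have formula: "real (num_paths_diag n k) =
      4 ^ (n - k) * ((real n - (real k + 1) / 2) gchoose (n - k))" if "k \<le> n" for n k
  proof -
    have "real (num_paths_diag n k) = fps_nth (fps_X ^ k * ?F ^ Suc k) n"
      unfolding Der[symmetric] Der2_Cat riordan_def
      by (simp add: power_mult_distrib mult_ac del: fps_nth_compose_linear)
    also have "?F ^ Suc k = binomial_gf (- ((real k + 1) / 2))"
      by (subst binomial_gf_power) (simp add: field_simps)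
    also have "fps_nth (fps_X ^ k * binomial_gf (- ((real k + 1) / 2))) n
        = fps_nth (binomial_gf (- ((real k + 1) / 2))) (n - k)"
      using that by (simp add: fps_X_power_mult_nth del: fps_nth_compose_linear)
    also have "\<dots> = 4 ^ (n - k) * (((real k + 1) / 2 + real (n - k) - 1) gchoose (n - k))"
      by (rule binomial_gf_nth)
    also have "(real k + 1) / 2 + real (n - k) - 1 = real n - (real k + 1) / 2"
      using that by (simp add: of_nat_diff field_simps)
    finally show ?thesis .
  qed
  \<comment> \<open>Each diagonal step raises the first coordinate by one, so \<open>k\<close> from
    \<open>0\<close> to \<open>n\<close> covers all paths to \<open>(n, n)\<close>.\<close>
  have count_le: "count_list p (1, 1) \<le> n" if "p \<in> lattice_paths n" for p n
  proof -
    have "count_list p (1, 1) \<le> fst (sum_list p)" for p :: "(nat \<times> nat) list"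
      by (induction p) auto
    with that show ?thesis
      by (metis (mono_tags, lifting) fst_conv lattice_paths_def mem_Collect_eq)
  qed
  have "num_paths n = (\<Sum>k = 0..n. num_paths_diag n k)" for n
  proof -
    have "lattice_paths n = (\<Union>k\<in>{0..n}. diag_paths n k)"
      using count_le by (auto simp: diag_paths_def)
    then show ?thesis
      unfolding num_paths_def num
      by (simp only:, intro card_UN_disjoint) (auto simp: finite_diag_paths, auto simp: diag_paths_def)
  qed
  with Der formula show ?thesis by simp
qed

end
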